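(* Let $q\ge1$ be an integer and let $\mathfrak{a}\subseteq R_q$ be an ideal. Let $f\in R_q$ vanish on $$Z(\mathfrak{a})=\{X\in\mathbb{C}^{q(q+1)/2}: h(X)=0\text{ for every }h\in\mathfrak{a}\}.$$ Then $f\in\sqrt{\mathfrak{a}}$ (the radical taken in $R_q$). Equivalently, $f^r\in\mathfrak{a}$ for some integer $r>0$.
   Context: For an integer $q\ge1$, $S_q=\mathbb{C}[x_{ij}:1\le i\le j\le q]$ is the polynomial ring in the entries of a symmetric $q\times q$ matrix (with $x_{ij}=x_{ji}$). The symmetric group $\mathfrak{S}_q$ acts on $S_q$ by simultaneously permuting the indices, $\sigma\cdot x_{ij}=x_{\sigma(i)\sigma(j)}$, and $R_q=S_q^{\mathfrak{S}_q}$ is the invariant ring. Elements of $R_q$ are evaluated at points $X=(X_{ij})_{1\le i\le j\le q}\in\mathbb{C}^{q(q+1)/2}$ as polynomials in $S_q$. *)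

theory Defs
  imports
    Complex_Main
    "HOL-Library.Poly_Mapping"
    "HOL-Library.FuncSet"
    "HOL-Combinatorics.Permutations"
    "HOL-Algebra.Ideal"
begin

text \<open>
  Polynomials are finitely supported maps from monomials to coefficients, and monomials are
  finitely supported maps from variables to exponents.  The pair \<open>(i, j)\<close> with \<open>i \<le> j\<close> names
  the variable \<open>x\<^sub>i\<^sub>j\<close>.
\<close>

type_synonym matpoly = "(nat \<times> nat \<Rightarrow>\<^sub>0 nat) \<Rightarrow>\<^sub>0 complex"

definition var_index :: "nat \<Rightarrow> (nat \<times> nat) set" where
  "var_index q = {(i, j). 1 \<le> i \<and> i \<le> j \<and> j \<le> q}"

definition const :: "complex \<Rightarrow> matpoly" where
  "const c = Poly_Mapping.single 0 c"

text \<open>The sorting of the indices implements the convention \<open>x\<^sub>i\<^sub>j = x\<^sub>j\<^sub>i\<close>.\<close>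

definition xvar :: "nat \<Rightarrow> nat \<Rightarrow> matpoly" where
  "xvar i j = Poly_Mapping.single (Poly_Mapping.single (min i j, max i j) 1) 1"

definition symmat_polys :: "nat \<Rightarrow> matpoly set" where
  "symmat_polys q = {p. \<forall>m\<in>Poly_Mapping.keys p. Poly_Mapping.keys m \<subseteq> var_index q}"

text \<open>
  Substitution of \<open>\<theta> v\<close> for each variable \<open>v\<close>, with coefficients mapped by \<open>\<phi>\<close>.  Both evaluation
  at a point and the action of a permutation are instances.
\<close>

definition substitute ::
    "(complex \<Rightarrow> 'b::comm_ring_1) \<Rightarrow> (nat \<times> nat \<Rightarrow> 'b) \<Rightarrow> matpoly \<Rightarrow> 'b" where
  "substitute \<phi> \<theta> p =
     (\<Sum>m\<in>Poly_Mapping.keys p. \<phi> (Poly_Mapping.lookup p m) *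
        (\<Prod>v\<in>Poly_Mapping.keys m. \<theta> v ^ Poly_Mapping.lookup m v))"

definition evaluate :: "matpoly \<Rightarrow> (nat \<times> nat \<Rightarrow> complex) \<Rightarrow> complex" where
  "evaluate p X = substitute (\<lambda>c. c) X p"

definition perm_act :: "(nat \<Rightarrow> nat) \<Rightarrow> matpoly \<Rightarrow> matpoly" where
  "perm_act \<sigma> p = substitute const (\<lambda>(i, j). xvar (\<sigma> i) (\<sigma> j)) p"

definition S_ring :: "nat \<Rightarrow> matpoly ring" where
  "S_ring q = \<lparr>carrier = symmat_polys q, mult = (*), one = 1, zero = 0, add = (+)\<rparr>"

definition R_ring :: "nat \<Rightarrow> matpoly ring" where
  "R_ring q = (S_ring q)\<lparr>carrier :=
     {p \<in> carrier (S_ring q). \<forall>\<sigma>. \<sigma> permutes {1..q} \<longrightarrow> perm_act \<sigma> p = p}\<rparr>"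

definition points :: "nat \<Rightarrow> (nat \<times> nat \<Rightarrow> complex) set" where
  "points q = var_index q \<rightarrow>\<^sub>E UNIV"

definition zero_set :: "nat \<Rightarrow> matpoly set \<Rightarrow> (nat \<times> nat \<Rightarrow> complex) set" where
  "zero_set q \<aa> = {X \<in> points q. \<forall>h\<in>\<aa>. evaluate h X = 0}"

definition radical_in :: "('a, 'm) ring_scheme \<Rightarrow> 'a set \<Rightarrow> 'a set" where
  "radical_in R I = {f \<in> carrier R. \<exists>r::nat. r > 0 \<and> f [^]\<^bsub>R\<^esub> r \<in> I}"

lemma card_var_index: "card (var_index q) = q * (q + 1) div 2"
proof -
  have eq: "var_index q = (SIGMA j:{1..q}. {1..j})\<inverse>"
    by (auto simp: var_index_def)
  have "card (var_index q) = card (SIGMA j:{1..q}. {1..j})"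
    unfolding eq by simp
  also have "\<dots> = (\<Sum>j\<in>{1..q}. j)" by simp
  also have "\<dots> = q * (q + 1) div 2"
    by (induction q) auto
  finally show ?thesis .
qed

lemma xvar_commute: "xvar i j = xvar j i"
  by (simp add: xvar_def min.commute max.commute)

lemma const_simps [simp]: "const 0 = 0" "const 1 = 1"
  by (simp_all add: const_def)

lemma const_add: "const (a + b) = const a + const b"
  by (simp add: const_def Poly_Mapping.single_add)

lemma const_mult: "const (a * b) = const a * const b"
  by (simp add: const_def Poly_Mapping.mult_single)

lemma poly_eq_sum_monomials:
  "p = (\<Sum>m\<in>Poly_Mapping.keys p. Poly_Mapping.single m (Poly_Mapping.lookup p m))"
proof (rule poly_mapping_eqI)
  fix k
  show "Poly_Mapping.lookup p k = Poly_Mapping.lookup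
      (\<Sum>m\<in>Poly_Mapping.keys p. Poly_Mapping.single m (Poly_Mapping.lookup p m)) k"
    by (cases "k \<in> Poly_Mapping.keys p")
      (auto simp: lookup_sum lookup_single when_def in_keys_iff)
qed

context
  fixes \<phi> :: "complex \<Rightarrow> 'b::comm_ring_1" and \<theta> :: "nat \<times> nat \<Rightarrow> 'b"
  assumes \<phi>0: "\<phi> 0 = 0" and \<phi>1: "\<phi> 1 = 1"
    and \<phi>_add: "\<And>a b. \<phi> (a + b) = \<phi> a + \<phi> b"
    and \<phi>_mult: "\<And>a b. \<phi> (a * b) = \<phi> a * \<phi> b"
begin

lemma substitute_superset:
  assumes "finite A" "Poly_Mapping.keys p \<subseteq> A"
  shows "substitute \<phi> \<theta> p = (\<Sum>m\<in>A. \<phi> (Poly_Mapping.lookup p m) *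
           (\<Prod>v\<in>Poly_Mapping.keys m. \<theta> v ^ Poly_Mapping.lookup m v))"
  unfolding substitute_def
  by (rule sum.mono_neutral_left) (use assms \<phi>0 in \<open>auto simp: in_keys_iff\<close>)

lemma substitute_add: "substitute \<phi> \<theta> (p + r) = substitute \<phi> \<theta> p + substitute \<phi> \<theta> r"
proof -
  let ?A = "Poly_Mapping.keys p \<union> Poly_Mapping.keys r"
  have "Poly_Mapping.keys (p + r) \<subseteq> ?A" by (rule Poly_Mapping.keys_add)
  then show ?thesis
    by (simp add: substitute_superset[of ?A] lookup_add \<phi>_add distrib_right sum.distrib)
qed

lemma substitute_zero: "substitute \<phi> \<theta> 0 = 0"
  by (simp add: substitute_def)

lemma substitute_one: "substitute \<phi> \<theta> 1 = 1"
  by (simp add: substitute_def \<phi>1)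

lemma substitute_sum: "substitute \<phi> \<theta> (sum g A) = (\<Sum>a\<in>A. substitute \<phi> \<theta> (g a))"
  by (induction A rule: infinite_finite_induct)
    (simp_all add: substitute_add substitute_zero)

lemma substitute_single:
  "substitute \<phi> \<theta> (Poly_Mapping.single m c) =
     \<phi> c * (\<Prod>v\<in>Poly_Mapping.keys m. \<theta> v ^ Poly_Mapping.lookup m v)"
  by (cases "c = 0") (simp_all add: substitute_def \<phi>0)

lemma monomial_add:
  fixes m n :: "nat \<times> nat \<Rightarrow>\<^sub>0 nat"
  shows "(\<Prod>v\<in>Poly_Mapping.keys (m + n). \<theta> v ^ Poly_Mapping.lookup (m + n) v) =
    (\<Prod>v\<in>Poly_Mapping.keys m. \<theta> v ^ Poly_Mapping.lookup m v) *
    (\<Prod>v\<in>Poly_Mapping.keys n. \<theta> v ^ Poly_Mapping.lookup n v)"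
proof -
  let ?A = "Poly_Mapping.keys m \<union> Poly_Mapping.keys n"
  have sup: "(\<Prod>v\<in>Poly_Mapping.keys k. \<theta> v ^ Poly_Mapping.lookup k v) =
      (\<Prod>v\<in>?A. \<theta> v ^ Poly_Mapping.lookup k v)"
    if "Poly_Mapping.keys k \<subseteq> ?A" for k
    by (rule prod.mono_neutral_left) (use that in \<open>auto simp: in_keys_iff\<close>)
  show ?thesis
    unfolding sup[OF Poly_Mapping.keys_add] sup[OF Un_upper1] sup[OF Un_upper2]
    by (simp add: lookup_add power_add prod.distrib)
qed

lemma substitute_mult: "substitute \<phi> \<theta> (p * r) = substitute \<phi> \<theta> p * substitute \<phi> \<theta> r"
proof -
  have "p * r = (\<Sum>m\<in>Poly_Mapping.keys p. \<Sum>n\<in>Poly_Mapping.keys r.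
      Poly_Mapping.single (m + n) (Poly_Mapping.lookup p m * Poly_Mapping.lookup r n))"
    (is "_ = ?rhs")
  proof -
    have "p * r = (\<Sum>m\<in>Poly_Mapping.keys p. Poly_Mapping.single m (Poly_Mapping.lookup p m)) *
        (\<Sum>n\<in>Poly_Mapping.keys r. Poly_Mapping.single n (Poly_Mapping.lookup r n))"
      using poly_eq_sum_monomials[of p] poly_eq_sum_monomials[of r] by metis
    also have "\<dots> = ?rhs" by (simp only: sum_product mult_single)
    finally show ?thesis .
  qed
  then have "substitute \<phi> \<theta> (p * r) =
      (\<Sum>m\<in>Poly_Mapping.keys p. \<Sum>n\<in>Poly_Mapping.keys r.
        \<phi> (Poly_Mapping.lookup p m * Poly_Mapping.lookup r n) *
        (\<Prod>v\<in>Poly_Mapping.keys (m + n). \<theta> v ^ Poly_Mapping.lookup (m + n) v))"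
    by (simp only: substitute_sum substitute_single)
  also have "\<dots> = substitute \<phi> \<theta> p * substitute \<phi> \<theta> r"
    by (simp add: substitute_def sum_product monomial_add \<phi>_mult mult_ac)
  finally show ?thesis .
qed

end

lemmas perm_act_add = substitute_add[OF const_simps const_add const_mult,
  where \<theta> = "\<lambda>(i, j). xvar (\<sigma> i) (\<sigma> j)" for \<sigma>, folded perm_act_def]
lemmas perm_act_mult = substitute_mult[OF const_simps const_add const_mult,
  where \<theta> = "\<lambda>(i, j). xvar (\<sigma> i) (\<sigma> j)" for \<sigma>, folded perm_act_def]

lemma perm_act_zero: "perm_act \<sigma> 0 = 0"
  by (simp add: perm_act_def substitute_def)

lemma perm_act_one: "perm_act \<sigma> 1 = 1"
  by (simp add: perm_act_def substitute_def)

lemma perm_act_const: "perm_act \<sigma> (const c) = const c"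
  by (cases "c = 0") (simp_all add: perm_act_def substitute_def const_def)

lemma perm_act_uminus: "perm_act \<sigma> (- p) = - perm_act \<sigma> p"
  by (rule minus_unique[symmetric]) (simp flip: perm_act_add add: perm_act_zero)

lemma perm_act_xvar: "perm_act \<sigma> (xvar i j) = xvar (\<sigma> i) (\<sigma> j)"
  by (cases "i \<le> j") (simp_all add: perm_act_def substitute_def xvar_def min_def max_def)

lemma evaluate_xvar: "evaluate (xvar i j) X = X (min i j, max i j)"
  by (simp add: evaluate_def substitute_def xvar_def)

lemma symmat_polys_add: "p \<in> symmat_polys q \<Longrightarrow> r \<in> symmat_polys q \<Longrightarrow> p + r \<in> symmat_polys q"
  using Poly_Mapping.keys_add[of p r] by (auto simp: symmat_polys_def)

lemma symmat_polys_mult: "p \<in> symmat_polys q \<Longrightarrow> r \<in> symmat_polys q \<Longrightarrow> p * r \<in> symmat_polys q"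
proof -
  assume p: "p \<in> symmat_polys q" and r: "r \<in> symmat_polys q"
  show "p * r \<in> symmat_polys q"
    unfolding symmat_polys_def mem_Collect_eq
  proof
    fix k assume "k \<in> Poly_Mapping.keys (p * r)"
    then obtain m n where "m \<in> Poly_Mapping.keys p" "n \<in> Poly_Mapping.keys r" "k = m + n"
      using keys_mult[of p r] by blast
    then show "Poly_Mapping.keys k \<subseteq> var_index q"
      using p r Poly_Mapping.keys_add[of m n] unfolding symmat_polys_def by blast
  qed
qed

lemma symmat_polys_uminus: "p \<in> symmat_polys q \<Longrightarrow> - p \<in> symmat_polys q"
  by (simp add: symmat_polys_def in_keys_iff)

lemma symmat_polys_zero: "0 \<in> symmat_polys q"
  by (simp add: symmat_polys_def)

lemma symmat_polys_one: "1 \<in> symmat_polys q"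
  by (simp add: symmat_polys_def)

lemma cring_S_ring: "cring (S_ring q)"
proof (rule cringI)
  show "abelian_group (S_ring q)"
  proof (rule abelian_groupI)
    fix p assume "p \<in> carrier (S_ring q)"
    then show "\<exists>r\<in>carrier (S_ring q). r \<oplus>\<^bsub>S_ring q\<^esub> p = \<zero>\<^bsub>S_ring q\<^esub>"
      by (intro bexI[of _ "- p"]) (auto simp: S_ring_def symmat_polys_uminus)
  qed (auto simp: S_ring_def symmat_polys_add symmat_polys_zero add_ac)
  show "comm_monoid (S_ring q)"
    by (rule comm_monoidI) (auto simp: S_ring_def symmat_polys_mult symmat_polys_one mult_ac)
qed (auto simp: S_ring_def distrib_right)

lemma cring_R_ring: "cring (R_ring q)"
proof (rule cringI)
  show "abelian_group (R_ring q)"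
  proof (rule abelian_groupI)
    fix p assume "p \<in> carrier (R_ring q)"
    then show "\<exists>r\<in>carrier (R_ring q). r \<oplus>\<^bsub>R_ring q\<^esub> p = \<zero>\<^bsub>R_ring q\<^esub>"
      by (intro bexI[of _ "- p"])
        (auto simp: R_ring_def S_ring_def symmat_polys_uminus perm_act_uminus)
  qed (auto simp: R_ring_def S_ring_def symmat_polys_add symmat_polys_zero
        perm_act_add perm_act_zero add_ac)
  show "comm_monoid (R_ring q)"
    by (rule comm_monoidI) (auto simp: R_ring_def S_ring_def symmat_polys_mult symmat_polys_one
        perm_act_mult perm_act_one mult_ac)
qed (auto simp: R_ring_def S_ring_def distrib_right)

end

theory Submission
  imports
    Defs
    "HOL-Analysis.Continuum_Not_Denumerable"
    "HOL-Computational_Algebra.Fundamental_Theorem_Algebra"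
begin

text \<open>
  The complex numbers are uncountable, while polynomials in countably many variables have countable
  dimension over them.  Suppose no power of \<open>f\<close> lies in the ideal that \<open>\<aa>\<close> generates in the
  polynomial ring, and let \<open>P\<close> be maximal among the ideals containing \<open>\<aa>\<close> but no power of \<open>f\<close>;
  then \<open>P\<close> is prime.  If a polynomial \<open>t\<close> were congruent to no constant modulo \<open>P\<close>, then
  \<open>f\<^sup>n = h\<^sub>c (t - c)\<close> modulo \<open>P\<close> for every \<open>c\<close>, with \<open>n\<close> depending on \<open>c\<close>.  A linear relation
  among the \<open>h\<^sub>c\<close> with a common \<open>n\<close> yields a nonzero univariate polynomial vanishing at \<open>t\<close> modulo
  \<open>P\<close>; it splits into linear factors, so some \<open>t - c\<close> lies in \<open>P\<close> after all.  Applied to the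
  variables, this gives a common zero \<open>x\<close> of \<open>\<aa>\<close> with \<open>f - f(x)\<close> in \<open>P\<close>, so \<open>f(x)\<close> is nonzero, a
  contradiction.  Averaging over the symmetric group brings the power of \<open>f\<close> back into \<open>\<aa>\<close>.
\<close>

section \<open>Ideals maximal among those avoiding all powers of an element\<close>

text \<open>For a commutative ring as a module over itself, \<open>subspace\<close> means ideal and
  \<open>ring_mod.span A\<close> is the ideal generated by \<open>A\<close>.\<close>

interpretation ring_mod: module "(*) :: 'a::comm_ring_1 \<Rightarrow> 'a \<Rightarrow> 'a"
  by standard (simp_all add: algebra_simps)

text \<open>This simp rule is \<open>a * (b * x) = (a * b) * x\<close>, which loops with associativity.\<close>

declare ring_mod.scale_scale [simp del]

text \<open>Zorn's lemma, with unions bounding chains. For \<open>g\<close> outside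
  \<open>P\<close>, the ideal generated by \<open>g\<close> and \<open>P\<close> is strictly larger,
  so it contains a power of \<open>f\<close>.\<close>

lemma exists_maximal_avoiding_powers:
  fixes I :: "'a::comm_ring_1 set"
  assumes I: "ring_mod.subspace I" and f: "\<And>n. f ^ n \<notin> I"
  obtains P where "ring_mod.subspace P" "I \<subseteq> P" "\<And>n. f ^ n \<notin> P"
    "\<And>g. g \<notin> P \<Longrightarrow> \<exists>n h. f ^ n - h * g \<in> P"
proof -
  define \<A> where "\<A> = {J. ring_mod.subspace J \<and> I \<subseteq> J \<and> (\<forall>n. f ^ n \<notin> J)}"
  have "\<exists>M\<in>\<A>. \<forall>X\<in>\<A>. M \<subseteq> X \<longrightarrow> X = M"
  proof (rule subset_Zorn_nonempty)
    show "\<A> \<noteq> {}" using I f by (auto simp: \<A>_def)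
    fix C assume ne: "C \<noteq> {}" and ch: "subset.chain \<A> C"
    have sub: "ring_mod.subspace J" "I \<subseteq> J" "\<And>n. f ^ n \<notin> J" if "J \<in> C" for J
      using that ch by (auto simp: \<A>_def subset.chain_def)
    have "ring_mod.subspace (\<Union>C)"
      unfolding ring_mod.subspace_def
    proof (intro conjI ballI allI)
      show "0 \<in> \<Union>C" using ne sub(1) ring_mod.subspace_0 by blast
      show "c * x \<in> \<Union>C" if "x \<in> \<Union>C" for c x
        using that sub(1) ring_mod.subspace_scale by blast
      fix x y assume "x \<in> \<Union>C" "y \<in> \<Union>C"
      then obtain J K where JK: "J \<in> C" "x \<in> J" "K \<in> C" "y \<in> K" by blast
      then have "J \<subseteq> K \<or> K \<subseteq> J" using ch unfolding subset_chain_def by blast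
      then show "x + y \<in> \<Union>C" using JK sub(1) ring_mod.subspace_add by blast
    qed
    moreover have "I \<subseteq> \<Union>C" using ne sub(2) by blast
    ultimately show "\<Union>C \<in> \<A>" using sub(3) by (auto simp: \<A>_def)
  qed
  then obtain P where P: "P \<in> \<A>" and max: "\<And>X. X \<in> \<A> \<Longrightarrow> P \<subseteq> X \<Longrightarrow> X = P" by blast
  have spanP: "ring_mod.span P = P"
    using P ring_mod.span_eq_iff[of P] by (simp add: \<A>_def)
  have "\<exists>n h. f ^ n - h * g \<in> P" if "g \<notin> P" for g
  proof (rule ccontr)
    assume neg: "\<nexists>n h. f ^ n - h * g \<in> P"
    let ?J = "ring_mod.span (insert g P)"
    have J: "x \<in> ?J \<longleftrightarrow> (\<exists>h. x - h * g \<in> P)" for x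
      by (simp add: ring_mod.span_insert spanP)
    have "P \<subseteq> ?J" by (auto intro: ring_mod.span_base)
    moreover have "I \<subseteq> P" using P by (simp add: \<A>_def)
    ultimately have "?J \<in> \<A>" using neg by (auto simp: \<A>_def J)
    then have "?J = P" using max \<open>P \<subseteq> ?J\<close> by blast
    then show False using that ring_mod.span_base[of g "insert g P"] by blast
  qed
  then show ?thesis using that[of P] P by (auto simp: \<A>_def)
qed

text \<open>Otherwise \<open>f ^ n = h * a\<close> and \<open>f ^ m = k * b\<close> modulo
  \<open>P\<close>, and multiplying them puts a power of \<open>f\<close> into
  \<open>P\<close>.\<close>

lemma prime_if_maximal_avoiding_powers:
  fixes P :: "'a::comm_ring_1 set"
  assumes P: "ring_mod.subspace P" and f: "\<And>n. f ^ n \<notin> P"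
    and max: "\<And>g. g \<notin> P \<Longrightarrow> \<exists>n h. f ^ n - h * g \<in> P"
    and ab: "a * b \<in> P"
  shows "a \<in> P \<or> b \<in> P"
proof (rule ccontr)
  assume "\<not> (a \<in> P \<or> b \<in> P)"
  then have ab': "a \<notin> P" "b \<notin> P" by auto
  obtain n h where 1: "f ^ n - h * a \<in> P" using max[OF ab'(1)] by auto
  obtain m k where 2: "f ^ m - k * b \<in> P" using max[OF ab'(2)] by auto
  have "f ^ (n + m) = f ^ m * (f ^ n - h * a) + (h * a) * (f ^ m - k * b) + (h * k) * (a * b)"
    unfolding power_add by (simp add: algebra_simps)
  also have "\<dots> \<in> P"
    by (intro ring_mod.subspace_add[OF P] ring_mod.subspace_scale[OF P] 1 2 ab)
  finally have "f ^ (n + m) \<in> P" .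
  then show False using f by blast
qed

section \<open>Univariate polynomials evaluated at a multivariate one\<close>

lemma const_minus: "const (- a) = - const a"
  by (metis add_eq_0_iff const_add const_simps(1) neg_eq_iff_add_eq_0)

lemma const_sum: "const (sum g A) = (\<Sum>a\<in>A. const (g a))"
  by (induction A rule: infinite_finite_induct) (simp_all add: const_add)

lemma const_prod: "const (prod g A) = (\<Prod>a\<in>A. const (g a))"
  by (induction A rule: infinite_finite_induct) (simp_all add: const_mult)

lemma const_power: "const (a ^ n) = const a ^ n"
  by (induction n) (simp_all add: const_mult)

lemma unit_const: "a \<noteq> 0 \<Longrightarrow> const (1 / a) * const a = 1"
  by (simp flip: const_mult)

definition poly_at :: "matpoly \<Rightarrow> complex poly \<Rightarrow> matpoly" where
  "poly_at t p = poly (map_poly const p) t"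

lemma poly_at_0 [simp]: "poly_at t 0 = 0"
  by (simp add: poly_at_def)

lemma poly_at_pCons [simp]: "poly_at t (pCons a p) = const a + t * poly_at t p"
  by (cases "p = 0 \<and> a = 0") (auto simp: poly_at_def map_poly_pCons)

lemma poly_at_1 [simp]: "poly_at t 1 = 1"
  by (simp add: one_pCons)

lemma poly_at_add: "poly_at t (p + r) = poly_at t p + poly_at t r"
  by (induction p r rule: poly_induct2) (simp_all add: const_add algebra_simps)

lemma poly_at_smult: "poly_at t (smult a p) = const a * poly_at t p"
  by (induction p) (simp_all add: const_mult algebra_simps)

lemma poly_at_mult: "poly_at t (p * r) = poly_at t p * poly_at t r"
  by (induction p) (simp_all add: poly_at_add poly_at_smult algebra_simps)

lemma poly_at_sum: "poly_at t (sum g A) = (\<Sum>a\<in>A. poly_at t (g a))"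
  by (induction A rule: infinite_finite_induct) (simp_all add: poly_at_add)

lemma poly_at_prod: "poly_at t (prod g A) = (\<Prod>a\<in>A. poly_at t (g a))"
  by (induction A rule: infinite_finite_induct) (simp_all add: poly_at_mult)

lemma poly_at_linear: "poly_at t [:- c, 1:] = t - const c"
  by (simp add: const_minus)

text \<open>A root \<open>z\<close> of \<open>u\<close> splits off a linear factor with value
  \<open>t - const z\<close> outside \<open>P\<close>, so primality passes membership on to the
  cofactor. A nonzero constant in \<open>P\<close> would give \<open>1 \<in> P\<close>.\<close>

lemma poly_at_mem_prime_imp_zero:
  assumes P: "ring_mod.subspace P" and "1 \<notin> P"
    and prime: "\<And>a b. a * b \<in> P \<Longrightarrow> a \<in> P \<or> b \<in> P"
    and t: "\<And>c. t - const c \<notin> P"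
    and "poly_at t u \<in> P"
  shows "u = 0"
  using assms(5)
proof (induction "degree u" arbitrary: u)
  case 0
  then obtain a where u: "u = [:a:]" by (metis degree_eq_zeroE)
  show ?case
  proof (rule ccontr)
    assume "u \<noteq> 0"
    then have "const (1 / a) * const a = 1" using u by (intro unit_const) auto
    moreover have "const a \<in> P" using 0 u by simp
    ultimately show False
      using \<open>1 \<notin> P\<close> P by (metis ring_mod.subspace_scale)
  qed
next
  case (Suc n)
  then obtain z where "poly u z = 0"
    using fundamental_theorem_of_algebra constant_degree by (metis nat.distinct(1))
  then obtain v where v: "u = [:- z, 1:] * v" by (metis dvdE poly_eq_0_iff_dvd)
  have "v \<noteq> 0" using Suc v by auto
  then have "degree u = Suc (degree v)" unfolding v by (subst degree_mult_eq) auto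
  moreover have "poly_at t v \<in> P"
    using Suc.prems prime t unfolding v poly_at_mult poly_at_linear by blast
  ultimately show ?case using Suc \<open>v \<noteq> 0\<close> by auto
qed

section \<open>Congruence to constants by a cardinality argument\<close>

text \<open>The scalars are now complex numbers instead of ring elements, so that dimension and
  linear dependence make sense.\<close>

interpretation matpoly_vs: vector_space "\<lambda>c (p :: matpoly). const c * p"
  by standard (simp_all add: algebra_simps const_add const_mult)

lemma uncountable_infinite_fibre:
  fixes g :: "'a \<Rightarrow> 'b"
  assumes "uncountable (UNIV :: 'a set)" "countable (range g)"
  obtains y where "infinite (g -` {y})"
proof -
  have "(UNIV :: 'a set) = (\<Union>y\<in>range g. g -` {y})" by auto
  then show ?thesis using assms that by (metis countable_UN countable_finite)
qed

text \<open>The graph of the exponents on the support determines a monomial and is a finite subset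
  of a countable set.\<close>

lemma countable_monomials: "countable (UNIV :: (nat \<times> nat \<Rightarrow>\<^sub>0 nat) set)"
proof -
  let ?g = "\<lambda>m :: nat \<times> nat \<Rightarrow>\<^sub>0 nat. (\<lambda>v. (v, Poly_Mapping.lookup m v)) ` Poly_Mapping.keys m"
  have "inj ?g"
  proof (rule injI)
    fix m n assume eq: "?g m = ?g n"
    have lk: "Poly_Mapping.lookup k v = e \<longleftrightarrow> (v, e) \<in> ?g k \<or> e = 0 \<and> (\<nexists>d. (v, d) \<in> ?g k)"
      for k v e by (auto simp: image_iff in_keys_iff)
    show "m = n"
      by (rule poly_mapping_eqI) (metis lk eq)
  qed
  moreover have "countable (range ?g)"
    by (rule countable_subset[OF _ countable_Collect_finite]) auto
  ultimately show ?thesis by (rule countable_image_inj_on[rotated])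
qed

lemma matpoly_in_span_monomials:
  assumes "Poly_Mapping.keys p \<subseteq> F"
  shows "p \<in> matpoly_vs.span ((\<lambda>m. Poly_Mapping.single m 1) ` F)"
proof -
  have "p = (\<Sum>m\<in>Poly_Mapping.keys p.
      const (Poly_Mapping.lookup p m) * Poly_Mapping.single m 1)"
    using poly_eq_sum_monomials[of p] by (simp add: const_def mult_single)
  also have "\<dots> \<in> matpoly_vs.span ((\<lambda>m. Poly_Mapping.single m 1) ` F)"
    using assms by (intro matpoly_vs.span_sum matpoly_vs.span_scale matpoly_vs.span_base) auto
  finally show ?thesis .
qed

lemma exists_const_congruent:
  fixes P :: "matpoly set"
  assumes P: "ring_mod.subspace P" and f: "\<And>n. f ^ n \<notin> P"
    and max: "\<And>g. g \<notin> P \<Longrightarrow> \<exists>n h. f ^ n - h * g \<in> P"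
  shows "\<exists>c. t - const c \<in> P"
proof (rule ccontr)
  assume "\<nexists>c. t - const c \<in> P"
  then have t: "t - const c \<notin> P" for c by blast
  note prime = prime_if_maximal_avoiding_powers[OF P f max]
  have "1 \<notin> P" using f[of 0] by simp
  have "\<forall>c. \<exists>n h. f ^ n - h * (t - const c) \<in> P" using max t by blast
  then obtain N h where h: "f ^ N c - h c * (t - const c) \<in> P" for c by metis
  \<comment> \<open>Exponents and finite supports range over a countable set, so infinitely many
    \<open>c\<close> share one exponent \<open>n\<close> and one support \<open>F\<close>.\<close>
  have "countable (range (\<lambda>c. (N c, Poly_Mapping.keys (h c))))"
  proof (rule countable_subset)
    show "range (\<lambda>c. (N c, Poly_Mapping.keys (h c))) \<subseteq>
        UNIV \<times> {A. finite A \<and> A \<subseteq> UNIV}" by auto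
    show "countable ((UNIV :: nat set) \<times> {A :: (nat \<times> nat \<Rightarrow>\<^sub>0 nat) set. finite A \<and> A \<subseteq> UNIV})"
      by (intro countable_SIGMA countable_Collect_finite_subset countable_monomials) auto
  qed
  then obtain y where "infinite ((\<lambda>c. (N c, Poly_Mapping.keys (h c))) -` {y})"
    using uncountable_infinite_fibre[OF uncountable_UNIV_complex] by metis
  moreover define n F where "n = fst y" and "F = snd y"
  moreover define C where "C = {c. N c = n \<and> Poly_Mapping.keys (h c) = F}"
  ultimately have "infinite C" by (simp add: vimage_def prod_eq_iff)
  have hC: "f ^ n - h c * (t - const c) \<in> P" if "c \<in> C" for c
    using h[of c] that by (simp add: C_def)
  have "finite F"
    using \<open>infinite C\<close> by (metis (mono_tags, lifting) C_def finite_keys infinite_imp_nonempty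
        ex_in_conv mem_Collect_eq)
  \<comment> \<open>If \<open>h c = h d\<close> with \<open>c \<noteq> d\<close>, the difference of
    the two relations puts \<open>h c\<close>, hence \<open>f ^ n\<close>, into
    \<open>P\<close>.\<close>
  have inj: "inj_on h C"
  proof (rule inj_onI, rule ccontr)
    fix c d assume cd: "c \<in> C" "d \<in> C" "h c = h d" "c \<noteq> d"
    have "(f ^ n - h c * (t - const c)) - (f ^ n - h c * (t - const d)) \<in> P"
      using hC[OF cd(1)] hC[OF cd(2)] cd(3) P by (metis ring_mod.subspace_diff)
    then have "const (c - d) * h c \<in> P"
      by (simp add: algebra_simps const_add[of "c - d" d, simplified])
    then have "const (1 / (c - d)) * const (c - d) * h c \<in> P"
      using P by (metis mult.assoc ring_mod.subspace_scale)
    then have "h c \<in> P" using cd(4) by (subst (asm) unit_const) auto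
    then have "f ^ n - h c * (t - const c) + (t - const c) * h c \<in> P"
      using hC[OF cd(1)] P by (metis ring_mod.subspace_add ring_mod.subspace_scale)
    then show False using f by (simp add: mult.commute)
  qed
  \<comment> \<open>Infinitely many distinct \<open>h c\<close> lie in a space of finite dimension,
    so they are linearly dependent.\<close>
  have "h ` C \<subseteq> matpoly_vs.span ((\<lambda>m. Poly_Mapping.single m 1) ` F)"
    by (auto simp: C_def intro: matpoly_in_span_monomials)
  then have "matpoly_vs.dependent (h ` C)"
    using matpoly_vs.independent_span_bound[of "(\<lambda>m. Poly_Mapping.single m 1) ` F" "h ` C"]
      \<open>finite F\<close> \<open>infinite C\<close> inj by (auto simp: finite_image_iff)
  then obtain B0 a0 where B0: "finite B0" "B0 \<subseteq> h ` C" "(\<Sum>v\<in>B0. const (a0 v) * v) = 0"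
      "\<exists>v\<in>B0. a0 v \<noteq> 0"
    unfolding matpoly_vs.dependent_explicit by blast
  then obtain B where B: "B \<subseteq> C" "B0 = h ` B" by (meson subset_imageE)
  have injB: "inj_on h B" using inj B inj_on_subset by blast
  have finB: "finite B" using B0(1) B(2) injB finite_image_iff by blast
  define a where "a c = a0 (h c)" for c
  have lin: "(\<Sum>c\<in>B. const (a c) * h c) = 0"
    using B0(3) injB by (simp add: B(2) a_def sum.reindex)
  obtain c0 where c0: "c0 \<in> B" "a c0 \<noteq> 0" using B0(4) B(2) by (auto simp: a_def)
  \<comment> \<open>The numerator of the sum of the fractions \<open>a c / (T - c)\<close>: modulo
    \<open>P\<close>, \<open>h c\<close> acts as \<open>f ^ n / (t - c)\<close>. At
    \<open>c0\<close> only the summand for \<open>c0\<close> survives.\<close>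
  define u where "u = (\<Sum>c\<in>B. smult (a c) (\<Prod>d\<in>B-{c}. [:- d, 1:]))"
  have "poly u c0 = (\<Sum>c\<in>B. a c * (\<Prod>d\<in>B-{c}. c0 - d))"
    by (simp add: u_def poly_sum poly_prod)
  also have "\<dots> = a c0 * (\<Prod>d\<in>B-{c0}. c0 - d)"
    using finB c0(1) by (subst sum.remove[of _ c0]) (auto intro!: sum.neutral)
  also have "\<dots> \<noteq> 0" using finB c0(2) by auto
  finally have "u \<noteq> 0" by auto
  let ?Q = "\<lambda>c. \<Prod>d\<in>B-{c}. t - const d"
  have E: "poly_at t u = (\<Sum>c\<in>B. const (a c) * ?Q c)"
    by (simp only: u_def poly_at_sum poly_at_smult poly_at_prod poly_at_linear)
  \<comment> \<open>The second terms all share the full product over \<open>B\<close>, so they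
    cancel by the linear relation \<open>lin\<close>.\<close>
  have "f ^ n * poly_at t u =
      (\<Sum>c\<in>B. (const (a c) * ?Q c) * (f ^ n - h c * (t - const c))
        + const (a c) * h c * (\<Prod>d\<in>B. t - const d))"
    unfolding E sum_distrib_left
    by (rule sum.cong) (simp_all add: finB prod.remove[of B] algebra_simps)
  also have "\<dots> = (\<Sum>c\<in>B. (const (a c) * ?Q c) * (f ^ n - h c * (t - const c)))"
    using lin by (simp add: sum.distrib flip: sum_distrib_right)
  also have "\<dots> \<in> P"
    using B(1) hC P by (intro ring_mod.subspace_sum ring_mod.subspace_scale) auto
  finally have "poly_at t u \<in> P" using prime f by blast
  then have "u = 0"
    using poly_at_mem_prime_imp_zero[OF P \<open>1 \<notin> P\<close> prime t] by blast
  then show False using \<open>u \<noteq> 0\<close> by contradiction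
qed

section \<open>Evaluation modulo an ideal and the Nullstellensatz for the generated ideal\<close>

lemma prod_variables_eq_single:
  fixes m :: "nat \<times> nat \<Rightarrow>\<^sub>0 nat"
  shows "(\<Prod>v\<in>Poly_Mapping.keys m. (Poly_Mapping.single (Poly_Mapping.single v 1) 1 :: matpoly)
     ^ Poly_Mapping.lookup m v) = Poly_Mapping.single m 1"
proof -
  have pow: "(Poly_Mapping.single (Poly_Mapping.single v 1) 1 :: matpoly) ^ n =
      Poly_Mapping.single (Poly_Mapping.single v n) 1" for v n
    by (induction n) (simp_all add: mult_single flip: single_add single_one)
  have "(\<Prod>v\<in>A. (Poly_Mapping.single (Poly_Mapping.single v 1) 1 :: matpoly)
     ^ Poly_Mapping.lookup m v) =
     Poly_Mapping.single (\<Sum>v\<in>A. Poly_Mapping.single v (Poly_Mapping.lookup m v)) 1"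
    if "finite A" for A
    using that unfolding pow by (induction A) (simp_all add: mult_single)
  moreover have "(\<Sum>v\<in>Poly_Mapping.keys m. Poly_Mapping.single v (Poly_Mapping.lookup m v)) = m"
    by (rule poly_mapping_eqI)
      (auto simp: lookup_sum lookup_single when_def in_keys_iff)
  ultimately show ?thesis by simp
qed

lemma substitute_variables:
  "substitute const (\<lambda>v. Poly_Mapping.single (Poly_Mapping.single v 1) 1) p = p"
  unfolding substitute_def prod_variables_eq_single
  by (subst (4) poly_eq_sum_monomials) (simp add: const_def mult_single)

lemma substitute_consts: "substitute const (\<lambda>v. const (x v)) p = const (evaluate p x)"
  by (simp add: substitute_def evaluate_def const_sum const_prod const_mult const_power)

lemma congruent_mult:
  fixes P :: "'a::comm_ring_1 set"
  assumes "ring_mod.subspace P" "a - a' \<in> P" "b - b' \<in> P"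
  shows "a * b - a' * b' \<in> P"
proof -
  have "a * b - a' * b' = b * (a - a') + a' * (b - b')" by (simp add: algebra_simps)
  also have "\<dots> \<in> P"
    by (intro ring_mod.subspace_add ring_mod.subspace_scale assms)
  finally show ?thesis .
qed

text \<open>Congruence modulo an ideal respects powers, products and sums, and the coefficients
  agree on both sides.\<close>

lemma congruent_substitute:
  assumes P: "ring_mod.subspace P" and v: "\<And>v. \<theta> v - \<theta>' v \<in> P"
  shows "substitute \<phi> \<theta> p - substitute \<phi> \<theta>' p \<in> P"
proof -
  have zero: "0 \<in> P" using P by (rule ring_mod.subspace_0)
  have pow: "\<theta> v ^ n - \<theta>' v ^ n \<in> P" for v n
    by (induction n) (auto intro: zero congruent_mult[OF P] v)
  have "(\<Prod>v\<in>A. \<theta> v ^ e v) - (\<Prod>v\<in>A. \<theta>' v ^ e v) \<in> P" for A and e :: "nat \<times> nat \<Rightarrow> nat"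
    by (induction A rule: infinite_finite_induct) (auto intro: zero congruent_mult[OF P] pow)
  then show ?thesis
    unfolding substitute_def sum_subtractf[symmetric]
    by (intro ring_mod.subspace_sum[OF P] congruent_mult[OF P]) (simp_all add: zero)
qed

text \<open>Points of \<open>zero_set\<close> are undefined outside \<open>var_index q\<close>,
  while the common zero found below assigns a value to every variable.\<close>

lemma evaluate_restrict:
  assumes "p \<in> symmat_polys q"
  shows "evaluate p (restrict x (var_index q)) = evaluate p x"
  unfolding evaluate_def substitute_def
  by (intro sum.cong prod.cong refl arg_cong2[where f = "(*)"] arg_cong2[where f = "(^)"])
    (use assms in \<open>auto simp: symmat_polys_def\<close>)

lemma nullstellensatz_span:
  assumes A: "A \<subseteq> symmat_polys q" and f: "f \<in> symmat_polys q"
    and van: "\<And>X. X \<in> zero_set q A \<Longrightarrow> evaluate f X = 0"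
  shows "\<exists>n. f ^ n \<in> ring_mod.span A"
proof (rule ccontr)
  assume "\<nexists>n. f ^ n \<in> ring_mod.span A"
  then obtain P where P: "ring_mod.subspace P" "ring_mod.span A \<subseteq> P" "\<And>n. f ^ n \<notin> P"
    and max: "\<And>g. g \<notin> P \<Longrightarrow> \<exists>n h. f ^ n - h * g \<in> P"
    using exists_maximal_avoiding_powers[OF ring_mod.subspace_span, of f A] by metis
  have "\<forall>v. \<exists>c. Poly_Mapping.single (Poly_Mapping.single v 1) 1 - const c \<in> P"
    using exists_const_congruent[OF P(1,3) max] by blast
  then obtain x where x: "Poly_Mapping.single (Poly_Mapping.single v 1) 1 - const (x v) \<in> P" for v
    by metis
  \<comment> \<open>Replacing each variable by its congruent constant \<open>x v\<close> turns
    \<open>p\<close> into its value at \<open>x\<close>.\<close>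
  have eval: "p - const (evaluate p x) \<in> P" for p
    using congruent_substitute[OF P(1), of _ "\<lambda>v. const (x v)" const p, OF x]
    unfolding substitute_variables substitute_consts .
  \<comment> \<open>A nonzero value would be a unit in \<open>P\<close>, contradicting
    \<open>f ^ 0 \<notin> P\<close>.\<close>
  have "evaluate h x = 0" if "h \<in> A" for h
  proof (rule ccontr)
    assume nz: "evaluate h x \<noteq> 0"
    have "h \<in> P" using that P(2) ring_mod.span_base by blast
    then have "h - (h - const (evaluate h x)) \<in> P"
      using eval P(1) ring_mod.subspace_diff by blast
    then have "const (1 / evaluate h x) * const (evaluate h x) \<in> P"
      using ring_mod.subspace_scale[OF P(1)] by simp
    then show False using nz P(3)[of 0] by (simp add: unit_const)
  qed
  then have "restrict x (var_index q) \<in> zero_set q A"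
    using A by (auto simp: zero_set_def points_def evaluate_restrict)
  then have "evaluate f x = 0" using van evaluate_restrict[OF f] by metis
  then show False using eval[of f] P(3)[of 1] by simp
qed

section \<open>Averaging over the symmetric group\<close>

text \<open>
  Membership in \<open>ring_mod.span \<aa>\<close> allows multipliers in variables outside \<open>var_index q\<close>; setting
  those variables to \<open>0\<close> brings them into \<open>symmat_polys q\<close>.
\<close>

definition trunc_act :: "nat \<Rightarrow> (nat \<Rightarrow> nat) \<Rightarrow> matpoly \<Rightarrow> matpoly" where
  "trunc_act q \<sigma> p =
     substitute const (\<lambda>v. if v \<in> var_index q then xvar (\<sigma> (fst v)) (\<sigma> (snd v)) else 0) p"

lemmas trunc_act_add = substitute_add[OF const_simps const_add const_mult,
  where \<theta> = "\<lambda>v. if v \<in> var_index q then xvar (\<sigma> (fst v)) (\<sigma> (snd v)) else 0" for q \<sigma>,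
  folded trunc_act_def]

lemmas trunc_act_mult = substitute_mult[OF const_simps const_add const_mult,
  where \<theta> = "\<lambda>v. if v \<in> var_index q then xvar (\<sigma> (fst v)) (\<sigma> (snd v)) else 0" for q \<sigma>,
  folded trunc_act_def]

lemma trunc_act_eq_perm_act:
  assumes "p \<in> symmat_polys q"
  shows "trunc_act q \<sigma> p = perm_act \<sigma> p"
  unfolding trunc_act_def perm_act_def substitute_def
  by (intro sum.cong prod.cong refl arg_cong2[where f = "(*)"] arg_cong2[where f = "(^)"])
    (use assms in \<open>auto simp: symmat_polys_def split: prod.splits\<close>)

lemma perm_act_sum: "perm_act \<tau> (sum g A) = (\<Sum>a\<in>A. perm_act \<tau> (g a))"
  by (induction A rule: infinite_finite_induct) (simp_all add: perm_act_add perm_act_zero)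

lemma perm_act_prod: "perm_act \<tau> (prod g A) = (\<Prod>a\<in>A. perm_act \<tau> (g a))"
  by (induction A rule: infinite_finite_induct) (simp_all add: perm_act_mult perm_act_one)

lemma perm_act_power: "perm_act \<tau> (p ^ n) = perm_act \<tau> p ^ n"
  by (induction n) (simp_all add: perm_act_mult perm_act_one)

lemma perm_act_trunc_act: "perm_act \<tau> (trunc_act q \<sigma> p) = trunc_act q (\<tau> \<circ> \<sigma>) p"
  unfolding trunc_act_def substitute_def
  by (simp add: perm_act_sum perm_act_mult perm_act_prod perm_act_power perm_act_const
      if_distrib[of "perm_act \<tau>"] perm_act_xvar perm_act_zero cong: if_cong)

lemma symmat_polys_sum: "(\<And>a. a \<in> A \<Longrightarrow> g a \<in> symmat_polys q) \<Longrightarrow> sum g A \<in> symmat_polys q"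
  by (induction A rule: infinite_finite_induct)
    (simp_all add: symmat_polys_add symmat_polys_zero)

lemma symmat_polys_prod: "(\<And>a. a \<in> A \<Longrightarrow> g a \<in> symmat_polys q) \<Longrightarrow> prod g A \<in> symmat_polys q"
  by (induction A rule: infinite_finite_induct)
    (simp_all add: symmat_polys_mult symmat_polys_one)

lemma symmat_polys_power: "p \<in> symmat_polys q \<Longrightarrow> p ^ n \<in> symmat_polys q"
  by (induction n) (simp_all add: symmat_polys_mult symmat_polys_one)

lemma symmat_polys_const: "const c \<in> symmat_polys q"
  by (simp add: symmat_polys_def const_def)

lemma symmat_polys_xvar:
  "i \<in> {1..q} \<Longrightarrow> j \<in> {1..q} \<Longrightarrow> xvar i j \<in> symmat_polys q"
  by (auto simp: symmat_polys_def xvar_def var_index_def)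

lemma trunc_act_in_symmat_polys:
  assumes "\<sigma> permutes {1..q}"
  shows "trunc_act q \<sigma> p \<in> symmat_polys q"
proof -
  have "xvar (\<sigma> i) (\<sigma> j) \<in> symmat_polys q" if "(i, j) \<in> var_index q" for i j
    using that permutes_in_image[OF assms]
    by (intro symmat_polys_xvar) (auto simp: var_index_def)
  then show ?thesis
    unfolding trunc_act_def substitute_def
    by (intro symmat_polys_sum symmat_polys_mult symmat_polys_prod symmat_polys_power
        symmat_polys_const) (auto simp: symmat_polys_zero)
qed

text \<open>The Reynolds operator times \<open>fact q\<close>, preceded by setting the variables
  outside \<open>var_index q\<close> to \<open>0\<close>.\<close>

definition orbit_sum :: "nat \<Rightarrow> matpoly \<Rightarrow> matpoly" where
  "orbit_sum q p = (\<Sum>\<sigma> | \<sigma> permutes {1..q}. trunc_act q \<sigma> p)"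

lemma R_ring_simps [simp]:
  "p \<in> carrier (R_ring q) \<longleftrightarrow>
     p \<in> symmat_polys q \<and> (\<forall>\<sigma>. \<sigma> permutes {1..q} \<longrightarrow> perm_act \<sigma> p = p)"
  "x \<otimes>\<^bsub>R_ring q\<^esub> y = x * y" "x \<oplus>\<^bsub>R_ring q\<^esub> y = x + y"
  "\<zero>\<^bsub>R_ring q\<^esub> = 0" "\<one>\<^bsub>R_ring q\<^esub> = 1"
  by (simp_all add: R_ring_def S_ring_def)

lemma R_ring_pow: "x [^]\<^bsub>R_ring q\<^esub> (n::nat) = x ^ n"
  by (induction n) (simp_all add: nat_pow_def mult.commute)

text \<open>Acting by \<open>\<tau>\<close> only reindexes the sum, since left composition permutes
  the group.\<close>

lemma orbit_sum_in_R_ring: "orbit_sum q p \<in> carrier (R_ring q)"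
proof -
  have "perm_act \<tau> (orbit_sum q p) = orbit_sum q p" if "\<tau> permutes {1..q}" for \<tau>
    unfolding orbit_sum_def perm_act_sum perm_act_trunc_act
    by (rule setum_permutations_compose_left[OF that, symmetric])
  moreover have "orbit_sum q p \<in> symmat_polys q"
    unfolding orbit_sum_def by (intro symmat_polys_sum trunc_act_in_symmat_polys) simp
  ultimately show ?thesis by simp
qed

lemma orbit_sum_add: "orbit_sum q (p + r) = orbit_sum q p + orbit_sum q r"
  by (simp add: orbit_sum_def trunc_act_add sum.distrib)

lemma orbit_sum_mult_invariant:
  assumes "x \<in> carrier (R_ring q)"
  shows "orbit_sum q (p * x) = orbit_sum q p * x"
  using assms
  by (simp add: orbit_sum_def trunc_act_mult trunc_act_eq_perm_act sum_distrib_right)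

lemma orbit_sum_invariant:
  assumes "x \<in> carrier (R_ring q)"
  shows "orbit_sum q x = const (fact q) * x"
proof -
  have fact: "const (of_nat n) = of_nat n" for n
    by (induction n) (simp_all add: const_add)
  have "orbit_sum q x = of_nat (card {\<sigma>. \<sigma> permutes {1..q}}) * x"
    using assms by (simp add: orbit_sum_def trunc_act_eq_perm_act)
  also have "card {\<sigma>. \<sigma> permutes {1..q}} = fact q"
    by (rule card_permutations) auto
  finally show ?thesis by (simp flip: fact)
qed

text \<open>Applying \<open>orbit_sum\<close> to a combination of elements of \<open>\<aa>\<close>
  makes the multipliers invariant and keeps the elements of \<open>\<aa>\<close>; it multiplies
  \<open>x\<close> by \<open>fact q\<close>, which is invertible.\<close>

lemma invariant_in_span_imp_in_ideal:
  assumes I: "ideal \<aa> (R_ring q)" and x: "x \<in> carrier (R_ring q)" "x \<in> ring_mod.span \<aa>"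
  shows "x \<in> \<aa>"
proof -
  have sub: "\<aa> \<subseteq> carrier (R_ring q)"
    using ideal.Icarr[OF I] by blast
  have add: "a + b \<in> \<aa>" if "a \<in> \<aa>" "b \<in> \<aa>" for a b
    using additive_subgroup.a_closed[OF ideal.axioms(1)[OF I] that] by simp
  have scale: "s * a \<in> \<aa>" if "s \<in> carrier (R_ring q)" "a \<in> \<aa>" for s a
    using ideal.I_l_closed[OF I that(2,1)] by simp
  have "orbit_sum q x \<in> \<aa>"
    using x(2)
  proof (induction rule: ring_mod.span_induct_alt)
    case base
    have "orbit_sum q 0 = 0"
      using orbit_sum_invariant[of 0 q] by (simp add: symmat_polys_zero perm_act_zero)
    then show ?case
      using additive_subgroup.zero_closed[OF ideal.axioms(1)[OF I]] by simp
  next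
    case (step c a y)
    then have "orbit_sum q (c * a + y) = orbit_sum q c * a + orbit_sum q y"
      using sub by (subst orbit_sum_add, subst orbit_sum_mult_invariant) auto
    also have "\<dots> \<in> \<aa>"
      by (intro add scale orbit_sum_in_R_ring step)
    finally show ?case .
  qed
  then have "const (fact q) * x \<in> \<aa>" using orbit_sum_invariant[OF x(1)] by simp
  then have "const (1 / fact q) * (const (fact q) * x) \<in> \<aa>"
    by (rule scale[rotated]) (simp add: symmat_polys_const perm_act_const)
  moreover have "const (1 / fact q) * (const (fact q) * x) = x"
    by (metis fact_nonzero mult.assoc mult_1_left unit_const)
  ultimately show ?thesis by simp
qed

theorem theorem5p9:
  fixes q :: nat and \<aa> :: "matpoly set" and f :: matpoly
  assumes "q \<ge> 1"
    and "ideal \<aa> (R_ring q)"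
    and "f \<in> carrier (R_ring q)"
    and "\<forall>X\<in>zero_set q \<aa>. evaluate f X = 0"
  shows "f \<in> radical_in (R_ring q) \<aa>
       \<and> (\<exists>r::nat. r > 0 \<and> f [^]\<^bsub>R_ring q\<^esub> r \<in> \<aa>)"
proof -
  have "\<aa> \<subseteq> symmat_polys q"
    using ideal.Icarr[OF assms(2)] by auto
  then obtain n where "f ^ n \<in> ring_mod.span \<aa>"
    using nullstellensatz_span[of \<aa> q f] assms(3,4) by auto
  \<comment> \<open>The exponent \<open>n\<close> may be \<open>0\<close>, while the radical asks
    for a positive one.\<close>
  then have "f ^ Suc n \<in> ring_mod.span \<aa>"
    using ring_mod.span_scale by simp
  moreover have "f ^ Suc n \<in> carrier (R_ring q)"
    using assms(3) by (auto simp del: power_Suc simp: symmat_polys_power perm_act_power)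
  ultimately have "f ^ Suc n \<in> \<aa>"
    using invariant_in_span_imp_in_ideal assms(2) by blast
  then have "\<exists>r::nat. r > 0 \<and> f [^]\<^bsub>R_ring q\<^esub> r \<in> \<aa>"
    unfolding R_ring_pow by blast
  then show ?thesis using assms(3) by (simp add: radical_in_def)
qed

end
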